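(* Let $m$ be a positive integer. (i) For every finite tree $T\subseteq\Sigma_m^*$, the self-similar fractal tree $F_T$ generated by $T$ is a path set over $\Sigma_m$ that has a right-resolving, irreducible presentation. (ii) Let $P\subseteq\Sigma_m^\infty$ be a path set over $\Sigma_m$ that has a right-resolving, irreducible presentation in which (a) every multiple edge terminates in the distinguished vertex, and (b) every (directed) cycle contains the distinguished vertex. Then $P$ is the self-similar fractal tree generated by some finite tree $T\subseteq\Sigma_m^*$, i.e. $P=F_T$.
   Context: $\Sigma_m=\{0,1,\dots,m-1\}$; $\Sigma_m^*$ is the set of finite strings and $\Sigma_m^\infty$ the set of infinite sequences over $\Sigma_m$. A tree is a subset of $\Sigma_m^*$ closed under taking initial segments. A finite tree $T$ is specified by a finite nonempty prefix-free set $S\subseteq\Sigma_m^*$ (no element is a proper initial segment of another), $T$ being the set of all initial segments of elements of $S$; the elements of $S$ are the terminal nodes of $T$. $T^*$ is the tree obtained by concatenating a copy of $T$ at each terminal node of $T$ and repeating recursively, i.e. the set of all initial segments of finite concatenations of terminal nodes of $T$. The self-similar fractal tree generated by $T$ is $F_T=[T^*]$, the set of $x\in\Sigma_m^\infty$ all of whose finite initial segments lie in $T^*$. A pointed graph over $\Sigma_m$ consists of a finite directed graph $G=(V,E)$ (loops and multiple edges permitted) whose edges are labeled with elements of $\Sigma_m$, together with a distinguished vertex $v\in V$; different edges from a vertex $u$ to a vertex $w$ must have distinct labels. The path set given by a pointed graph is the set of all infinite sequences in $\Sigma_m^\infty$ obtained by reading the edge labels along one-sided infinite directed walks in $G$ that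 begin at $v$. A path set over $\Sigma_m$ is a set arising in this way, and any pointed graph giving a path set $P$ is called a presentation of $P$. A presentation is right-resolving if for every vertex $u$, all directed edges starting from $u$ have distinct labels. It is irreducible if for every pair of vertices $u,w$ there is a directed walk in $G$ from $u$ to $w$ (walks of length zero are allowed). A multiple edge is one of two or more distinct edges having the same initial vertex and the same terminal vertex. *)

theory Defs
  imports "Graph_Theory.Digraph_Component" "HOL-Library.Sublist"
begin

section \<open>Trees over the alphabet \<open>{..<m}\<close>\<close>

definition prefix_free :: "'a list set \<Rightarrow> bool" where
  "prefix_free S \<longleftrightarrow> (\<forall>s\<in>S. \<forall>t\<in>S. \<not> strict_prefix s t)"

definition initial_segments :: "'a list set \<Rightarrow> 'a list set" where
  "initial_segments S = {p. \<exists>s\<in>S. prefix p s}"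

definition finite_tree :: "nat \<Rightarrow> nat list set \<Rightarrow> bool" where
  "finite_tree m T \<longleftrightarrow>
     (\<exists>S. finite S \<and> S \<noteq> {} \<and> S \<subseteq> lists {..<m} \<and> prefix_free S \<and> T = initial_segments S)"

text \<open>The specifying set of a finite tree can be recovered from the tree as its set of maximal
  nodes (lemma \<open>terminal_nodes_initial_segments\<close>), so the terminal nodes are a function of the
  tree alone.\<close>

definition terminal_nodes :: "'a list set \<Rightarrow> 'a list set" where
  "terminal_nodes T = {s\<in>T. \<forall>t\<in>T. \<not> strict_prefix s t}"

lemma terminal_nodes_initial_segments:
  assumes "prefix_free S"
  shows "terminal_nodes (initial_segments S) = S"
proof
  show "terminal_nodes (initial_segments S) \<subseteq> S"
  proof
    fix s assume s: "s \<in> terminal_nodes (initial_segments S)"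
    then obtain t where t: "t \<in> S" "prefix s t"
      by (auto simp: terminal_nodes_def initial_segments_def)
    then have "t \<in> initial_segments S"
      by (auto simp: initial_segments_def)
    with s have "\<not> strict_prefix s t"
      by (auto simp: terminal_nodes_def)
    with t show "s \<in> S"
      by (auto simp: strict_prefix_def)
  qed
  show "S \<subseteq> terminal_nodes (initial_segments S)"
  proof
    fix s assume s: "s \<in> S"
    have "\<not> strict_prefix s t" if t: "t \<in> initial_segments S" for t
    proof
      assume st: "strict_prefix s t"
      from t obtain u where u: "u \<in> S" "prefix t u"
        by (auto simp: initial_segments_def)
      with st have "strict_prefix s u"
        by (meson prefix_order.less_le_trans)
      with assms s u show False
        by (auto simp: prefix_free_def)
    qed
    with s show "s \<in> terminal_nodes (initial_segments S)"
      by (auto simp: terminal_nodes_def initial_segments_def)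
  qed
qed

definition tree_star :: "'a list set \<Rightarrow> 'a list set" where
  "tree_star T = initial_segments {concat ss | ss. ss \<in> lists (terminal_nodes T)}"

definition infinite_paths :: "nat \<Rightarrow> nat list set \<Rightarrow> (nat \<Rightarrow> nat) set" where
  "infinite_paths m U = {x. range x \<subseteq> {..<m} \<and> (\<forall>n. map x [0..<n] \<in> U)}"

definition fractal_tree :: "nat \<Rightarrow> nat list set \<Rightarrow> (nat \<Rightarrow> nat) set" where
  "fractal_tree m T = infinite_paths m (tree_star T)"

section \<open>Pointed graphs and path sets\<close>

locale pointed_graph = fin_digraph G for G :: "('v, 'e) pre_digraph" +
  fixes m :: nat and lab :: "'e \<Rightarrow> nat" and v :: 'v
  assumes label_in_alphabet: "e \<in> arcs G \<Longrightarrow> lab e < m"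
    and distinct_parallel_labels:
      "\<lbrakk>e \<in> arcs G; f \<in> arcs G; arc_to_ends G e = arc_to_ends G f; lab e = lab f\<rbrakk> \<Longrightarrow> e = f"
    and distinguished_vertex: "v \<in> verts G"

definition infinite_walk :: "('v, 'e) pre_digraph \<Rightarrow> 'v \<Rightarrow> (nat \<Rightarrow> 'e) \<Rightarrow> bool" where
  "infinite_walk G v w \<longleftrightarrow>
     range w \<subseteq> arcs G \<and> tail G (w 0) = v \<and> (\<forall>i. head G (w i) = tail G (w (Suc i)))"

definition presentation ::
    "nat \<Rightarrow> ('v, 'e) pre_digraph \<Rightarrow> ('e \<Rightarrow> nat) \<Rightarrow> 'v \<Rightarrow> (nat \<Rightarrow> nat) set \<Rightarrow> bool" where
  "presentation m G lab v P \<longleftrightarrow>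
     pointed_graph G m lab v \<and> P = {lab \<circ> w | w. infinite_walk G v w}"

definition right_resolving :: "('v, 'e) pre_digraph \<Rightarrow> ('e \<Rightarrow> nat) \<Rightarrow> bool" where
  "right_resolving G lab \<longleftrightarrow> (\<forall>u\<in>verts G. inj_on lab (out_arcs G u))"

definition multiple_edge :: "('v, 'e) pre_digraph \<Rightarrow> 'e \<Rightarrow> bool" where
  "multiple_edge G e \<longleftrightarrow>
     e \<in> arcs G \<and> (\<exists>f\<in>arcs G. f \<noteq> e \<and> arc_to_ends G f = arc_to_ends G e)"

text \<open>The existential quantifier needs fixed types of vertices and edges. As graphs are finite,
  \<open>nat\<close> loses no generality: see lemma \<open>presentation_imp_path_set\<close>.\<close>

definition path_set :: "nat \<Rightarrow> (nat \<Rightarrow> nat) set \<Rightarrow> bool" where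
  "path_set m P \<longleftrightarrow> (\<exists>(G :: (nat, nat) pre_digraph) lab v. presentation m G lab v P)"

lemma presentation_imp_path_set:
  fixes G :: "('v, 'e) pre_digraph"
  assumes "presentation m G lab v P"
  shows "path_set m P"
proof -
  interpret pointed_graph G m lab v
    using assms by (simp add: presentation_def)
  obtain f :: "'v \<Rightarrow> nat" where f: "inj_on f (verts G)"
    using finite_imp_inj_to_nat_seg[OF finite_verts] by blast
  obtain g :: "'e \<Rightarrow> nat" where g: "inj_on g (arcs G)"
    using finite_imp_inj_to_nat_seg[OF finite_arcs] by blast
  define h where "h = inv_into (arcs G) g"
  have hg: "h (g e) = e" if "e \<in> arcs G" for e
    using g that by (simp add: h_def)
  define H where "H = \<lparr>verts = f ` verts G, arcs = g ` arcs G,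
    tail = (\<lambda>a. f (tail G (h a))), head = (\<lambda>a. f (head G (h a)))\<rparr>"
  have feq: "f a = f b \<longleftrightarrow> a = b" if "a \<in> verts G" "b \<in> verts G" for a b
    using f that by (auto dest: inj_onD)
  have "pointed_graph H m (lab \<circ> h) (f v)"
  proof
    show "a = b" if "a \<in> arcs H" "b \<in> arcs H" "arc_to_ends H a = arc_to_ends H b"
        "(lab \<circ> h) a = (lab \<circ> h) b" for a b
    proof -
      obtain d e where de: "d \<in> arcs G" "e \<in> arcs G" "a = g d" "b = g e"
        using \<open>a \<in> arcs H\<close> \<open>b \<in> arcs H\<close> by (auto simp: H_def)
      with that have "arc_to_ends G d = arc_to_ends G e" "lab d = lab e"
        by (auto simp: H_def arc_to_ends_def hg feq)
      with de show "a = b"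
        using distinct_parallel_labels by blast
    qed
  qed (auto simp: H_def hg label_in_alphabet distinguished_vertex)
  moreover have "{lab \<circ> w | w. infinite_walk G v w} = {(lab \<circ> h) \<circ> w | w. infinite_walk H (f v) w}"
  proof (intro equalityI subsetI)
    fix x assume "x \<in> {lab \<circ> w | w. infinite_walk G v w}"
    then obtain w where w: "infinite_walk G v w" "x = lab \<circ> w"
      by blast
    then have wG: "w i \<in> arcs G" for i
      by (auto simp: infinite_walk_def)
    have "infinite_walk H (f v) (g \<circ> w)"
      using w wG by (auto simp: infinite_walk_def H_def hg)
    moreover have "x = (lab \<circ> h) \<circ> (g \<circ> w)"
      using w wG by (auto simp: hg)
    ultimately show "x \<in> {(lab \<circ> h) \<circ> w | w. infinite_walk H (f v) w}"
      by blast
  next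
    fix x assume "x \<in> {(lab \<circ> h) \<circ> w | w. infinite_walk H (f v) w}"
    then obtain w where w: "infinite_walk H (f v) w" "x = (lab \<circ> h) \<circ> w"
      by blast
    then have "w i \<in> g ` arcs G" for i
      by (auto simp: infinite_walk_def H_def)
    then have wG: "h (w i) \<in> arcs G" for i
      by (metis h_def inv_into_into)
    have "infinite_walk G v (h \<circ> w)"
      using w wG distinguished_vertex by (auto simp: infinite_walk_def H_def feq)
    moreover have "x = lab \<circ> (h \<circ> w)"
      using w by auto
    ultimately show "x \<in> {lab \<circ> w | w. infinite_walk G v w}"
      by blast
  qed
  ultimately have "presentation m H (lab \<circ> h) (f v) P"
    using assms by (auto simp: presentation_def)
  then show ?thesis
    by (auto simp: path_set_def)
qed

end

theory Submission
  imports Defs "HOL-Library.Countable"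
begin

text \<open>
  The bridge between graphs and trees is the set of \<^emph>\<open>return labels\<close> of a pointed graph: the label
  strings read along the closed walks that leave the distinguished vertex and come back to it only at
  their very end (first returns).

  In a strongly connected graph every finite walk from the distinguished vertex extends to a closed
  one, and a closed walk splits into first returns at its visits to the distinguished vertex. So the
  label strings of finite walks are exactly the initial segments of concatenations of return labels
  (\<open>walk_labels_eq_initial_segments\<close>). In a right-resolving graph a label string determines the walk
  that carries it, so walks reading longer and longer initial segments of an infinite sequence extend
  one another and merge into one infinite walk; hence the path set consists of the sequences all of
  whose initial segments are labels of finite walks (\<open>labels_of_infinite_walks\<close>). Together, the path
  set is built from the return labels just as \<open>F\<^sub>T\<close> is built from the terminal nodes of \<open>T\<close>
  (\<open>presentation_imp_return_labels\<close>).

  Both directions are now statements about return labels. For (i), fold the tree into a graph by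
  identifying its terminal nodes with the root; then a first return is a walk down one branch, and the
  return labels are the terminal nodes. For (ii), the return labels are prefix-free because a label
  string determines its walk, and there are finitely many of them because a first return, once its
  first edge is removed, repeats no vertex: a repetition would enclose a cycle that misses the
  distinguished vertex. They are therefore the terminal nodes of a finite tree.

  The one-point tree, whose only terminal node is the empty string, is the degenerate case: it
  corresponds to the graph without edges, which has no return labels at all. As the empty string
  contributes nothing to a concatenation, the two sets generate the same infinite sequences.
\<close>

section \<open>Concatenations of strings\<close>

lemma concat_lists_diff_Nil:
  "{concat ss | ss. ss \<in> lists (S - {[]})} = {concat ss | ss. ss \<in> lists S}"
proof (intro equalityI subsetI)
  fix x assume "x \<in> {concat ss | ss. ss \<in> lists S}"
  then obtain ss where ss: "ss \<in> lists S" "x = concat ss"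
    by blast
  have "concat (filter (\<lambda>s. s \<noteq> []) ss) = concat ss"
    by (induction ss) auto
  with ss have "filter (\<lambda>s. s \<noteq> []) ss \<in> lists (S - {[]})" "x = concat (filter (\<lambda>s. s \<noteq> []) ss)"
    by auto
  then show "x \<in> {concat ss | ss. ss \<in> lists (S - {[]})}"
    by blast
qed auto

lemma fractal_tree_initial_segments:
  assumes "prefix_free S"
  shows "fractal_tree m (initial_segments S) =
    infinite_paths m (initial_segments {concat ss | ss. ss \<in> lists (S - {[]})})"
  by (simp add: fractal_tree_def tree_star_def terminal_nodes_initial_segments[OF assms]
      concat_lists_diff_Nil)

lemma finite_initial_segments:
  assumes "finite S"
  shows "finite (initial_segments S)"
proof -
  have "initial_segments S = (\<Union>s\<in>S. set (prefixes s))"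
    by (auto simp: initial_segments_def)
  with assms show ?thesis
    by simp
qed

section \<open>Label strings of finite walks\<close>

text \<open>The part of a closed walk between two visits to the same vertex is a shorter closed walk. That
  the cycle uses only arcs of the walk is what makes it miss a vertex that the walk misses.\<close>

lemma (in wf_digraph) closed_walk_contains_cycle:
  assumes "awalk u p u" "p \<noteq> []"
  shows "\<exists>c. cycle c \<and> set c \<subseteq> set p"
  using assms
proof (induction "length p" arbitrary: u p rule: less_induct)
  case less
  show ?case
  proof (cases "distinct (tl (awalk_verts u p))")
    case True
    with less.prems show ?thesis
      by (auto simp: cycle_def)
  next
    case False
    obtain e es where p: "p = e # es"
      using less.prems by (cases p) auto
    with less.prems False have "awalk (head G e) es u" "\<not> distinct (awalk_verts (head G e) es)"
      by (auto simp: awalk_Cons_iff)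
    from awalk_not_distinct_decomp[OF this] obtain q r s w
      where dec: "es = q @ r @ s" "0 < length r" "awalk w r w"
      by blast
    with less.hyps[of r w] p obtain c where "cycle c" "set c \<subseteq> set r"
      by auto
    with p dec show ?thesis
      by auto
  qed
qed

context pointed_graph
begin

definition walk_labels :: "nat list set" where
  "walk_labels = {map lab p | p u. awalk v p u}"

definition return_walks :: "'e list set" where
  "return_walks = {p. awalk v p v \<and> p \<noteq> [] \<and> v \<notin> tail G ` set (tl p)}"

definition return_labels :: "nat list set" where
  "return_labels = map lab ` return_walks"

text \<open>Determinism: at each vertex the next label selects the next arc.\<close>

lemma right_resolving_prefix_walk:
  assumes "right_resolving G lab" "awalk u p x" "awalk u q y" "prefix (map lab p) (map lab q)"
  shows "prefix p q"
  using assms(2-4)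
proof (induction p arbitrary: u q)
  case (Cons e p)
  then obtain f q' where q: "q = f # q'" and ef: "lab e = lab f"
    by (cases q) auto
  have arcs: "e \<in> out_arcs G u" "f \<in> out_arcs G u" and "u \<in> verts G"
    using Cons.prems q by (auto simp: awalk_Cons_iff)
  then have "inj_on lab (out_arcs G u)"
    using assms(1) by (simp add: right_resolving_def)
  then have "e = f"
    using ef arcs by (rule inj_onD)
  moreover have "prefix p q'"
    using Cons.IH[of "head G e" q'] Cons.prems q \<open>e = f\<close> by (auto simp: awalk_Cons_iff)
  ultimately show ?case
    using q by simp
qed simp

lemma awalk_of_infinite_walk:
  assumes "infinite_walk G v w"
  shows "awalk v (map w [0..<n]) (tail G (w n))"
proof (induction n)
  case 0
  then show ?case
    using assms distinguished_vertex by (auto simp: infinite_walk_def awalk_Nil_iff)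
next
  case (Suc n)
  have "awalk (tail G (w n)) [w n] (tail G (w (Suc n)))"
    using assms arc_implies_awalk[of "w n"] by (auto simp: infinite_walk_def)
  with Suc show ?case
    using awalk_appendI by fastforce
qed

text \<open>A compactness property. The walks that read the initial segments of \<open>x\<close> could in general be
  unrelated; determinism makes each of them an initial part of the next.\<close>

lemma labels_of_infinite_walks:
  assumes "right_resolving G lab"
  shows "{lab \<circ> w | w. infinite_walk G v w} = infinite_paths m walk_labels"
proof (intro equalityI subsetI)
  fix x assume "x \<in> {lab \<circ> w | w. infinite_walk G v w}"
  then obtain w where w: "infinite_walk G v w" "x = lab \<circ> w"
    by blast
  then have "range x \<subseteq> {..<m}"
    by (auto simp: infinite_walk_def intro!: label_in_alphabet)
  moreover have "map x [0..<n] = map lab (map w [0..<n])" for n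
    using w(2) by simp
  then have "map x [0..<n] \<in> walk_labels" for n
    using awalk_of_infinite_walk[OF w(1)] unfolding walk_labels_def by blast
  ultimately show "x \<in> infinite_paths m walk_labels"
    by (simp add: infinite_paths_def)
next
  fix x assume "x \<in> infinite_paths m walk_labels"
  then have "\<forall>n. \<exists>p u. awalk v p u \<and> map x [0..<n] = map lab p"
    by (simp add: infinite_paths_def walk_labels_def) blast
  from choice[OF this] obtain p where "\<forall>n. \<exists>u. awalk v (p n) u \<and> map x [0..<n] = map lab (p n)"
    by blast
  from choice[OF this] obtain u where walk: "\<And>n. awalk v (p n) (u n)"
    and lab: "\<And>n. map x [0..<n] = map lab (p n)"
    by blast
  have len: "length (p n) = n" for n
    using arg_cong[OF lab, of length] by simp
  define w where "w n = p (Suc n) ! n" for n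
  have p: "p n = map w [0..<n]" for n
  proof (induction n)
    case (Suc n)
    have "prefix (map lab (p n)) (map lab (p (Suc n)))"
      by (simp flip: lab)
    then have "prefix (p n) (p (Suc n))"
      by (rule right_resolving_prefix_walk[OF assms walk walk])
    then have "p n = take n (p (Suc n))"
      using len[of n] by (auto simp: prefix_def)
    then have "p (Suc n) = p n @ [w n]"
      using take_Suc_conv_app_nth[of n "p (Suc n)"] len[of "Suc n"] by (simp add: w_def)
    with Suc show ?case
      by simp
  qed (use len[of 0] in simp)
  have "w i \<in> arcs G \<and> head G (w i) = tail G (w (Suc i))" for i
    using walk[of "Suc (Suc i)"] by (auto simp: p awalk_Cons_iff)
  moreover have "tail G (w 0) = v"
    using walk[of 1] by (auto simp: p awalk_Cons_iff)
  ultimately have "infinite_walk G v w"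
    by (auto simp: infinite_walk_def)
  moreover have "x n = lab (w n)" for n
    using lab[of "Suc n"] by (simp add: p)
  then have "x = lab \<circ> w"
    by auto
  ultimately show "x \<in> {lab \<circ> w | w. infinite_walk G v w}"
    by blast
qed

section \<open>First returns to the distinguished vertex\<close>

text \<open>A closed walk is cut at its visits to the distinguished vertex.\<close>

lemma closed_walk_split_returns:
  assumes "awalk v p v"
  shows "\<exists>rs\<in>lists return_walks. p = concat rs"
  using assms
proof (induction "length p" arbitrary: p rule: less_induct)
  case less
  show ?case
  proof (cases "p = [] \<or> p \<in> return_walks")
    case True
    then have "p = concat (if p = [] then [] else [p])"
      "(if p = [] then [] else [p]) \<in> lists return_walks"
      by auto
    then show ?thesis
      by blast
  next
    case False
    then obtain e p' where p: "p = e # p'" and "\<exists>f\<in>set p'. tail G f = v"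
      using less.prems by (cases p) (auto simp: return_walks_def)
    from split_list_first_prop[OF this(2)] obtain a f b
      where p': "p' = a @ f # b" "tail G f = v" and "\<forall>g\<in>set a. tail G g \<noteq> v"
      by blast
    then have a: "v \<notin> tail G ` set a"
      by auto
    have "awalk v (e # a) v" "awalk v (f # b) v"
      using less.prems p p' by (auto simp: awalk_Cons_iff)
    moreover from this have "e # a \<in> return_walks"
      using a by (simp add: return_walks_def)
    moreover obtain rs where "rs \<in> lists return_walks" "f # b = concat rs"
      using less.hyps[of "f # b"] p p' \<open>awalk v (f # b) v\<close> by auto
    ultimately have "(e # a) # rs \<in> lists return_walks" "p = concat ((e # a) # rs)"
      using p p' by auto
    then show ?thesis
      by blast
  qed
qed

lemma concat_returns_closed_walk:
  assumes "rs \<in> lists return_walks"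
  shows "awalk v (concat rs) v"
  using assms
proof (induction rs)
  case (Cons r rs)
  then have "awalk v r v" "awalk v (concat rs) v"
    by (auto simp: return_walks_def)
  then show ?case
    using awalk_appendI by fastforce
qed (simp add: awalk_Nil_iff distinguished_vertex)

lemma concat_return_labels:
  "{concat ss | ss. ss \<in> lists return_labels} = map lab ` {p. awalk v p v}"
proof (intro equalityI subsetI)
  fix x assume "x \<in> {concat ss | ss. ss \<in> lists return_labels}"
  then obtain ss where "ss \<in> lists return_labels" "x = concat ss"
    by blast
  then obtain rs where "rs \<in> lists return_walks" "x = map lab (concat rs)"
    by (auto simp: return_labels_def lists_image map_concat)
  then show "x \<in> map lab ` {p. awalk v p v}"
    using concat_returns_closed_walk by blast
next
  fix x assume "x \<in> map lab ` {p. awalk v p v}"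
  then obtain rs where "rs \<in> lists return_walks" "x = map lab (concat rs)"
    using closed_walk_split_returns by blast
  then have "map (map lab) rs \<in> lists return_labels" "x = concat (map (map lab) rs)"
    by (auto simp: return_labels_def map_concat)
  then show "x \<in> {concat ss | ss. ss \<in> lists return_labels}"
    by blast
qed

text \<open>Strong connectedness closes every walk that starts in the distinguished vertex.\<close>

lemma walk_labels_eq_initial_segments:
  assumes "strongly_connected G"
  shows "walk_labels = initial_segments {concat ss | ss. ss \<in> lists return_labels}"
  unfolding concat_return_labels
proof (intro equalityI subsetI)
  fix x assume "x \<in> walk_labels"
  then obtain p u where p: "awalk v p u" "x = map lab p"
    by (auto simp: walk_labels_def)
  then have "u \<in> verts G"
    by blast
  then obtain q where "awalk u q v"
    using assms distinguished_vertex unfolding strongly_connected_def reachable_awalk by blast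
  with p have "awalk v (p @ q) v"
    using awalk_appendI by blast
  moreover have "prefix x (map lab (p @ q))"
    using p by simp
  ultimately show "x \<in> initial_segments (map lab ` {p. awalk v p v})"
    unfolding initial_segments_def by blast
next
  fix x assume "x \<in> initial_segments (map lab ` {p. awalk v p v})"
  then obtain p where p: "awalk v p v" "prefix x (map lab p)"
    by (auto simp: initial_segments_def)
  define k where "k = length x"
  have "x = map lab (take k p)"
    using p(2) by (metis append_eq_conv_conj k_def prefixE take_map)
  moreover have "awalk v (take k p) (awlast v (take k p))"
    using p(1) awalk_append_iff[of v "take k p" "drop k p" v] by simp
  ultimately show "x \<in> walk_labels"
    unfolding walk_labels_def by blast
qed

lemma return_labels_not_Nil: "[] \<notin> return_labels"
  by (auto simp: return_labels_def return_walks_def)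

lemma return_labels_subset: "return_labels \<subseteq> lists {..<m}"
proof -
  have "lab ` set p \<subseteq> {..<m}" if "p \<in> return_walks" for p
    using that label_in_alphabet by (fastforce simp: return_walks_def)
  then show ?thesis
    unfolding return_labels_def by (simp add: image_subset_iff lists_eq_set)
qed

text \<open>If the label string of one first return properly extends that of another, then so does the
  walk, and the longer walk passes through the distinguished vertex too early.\<close>

lemma prefix_free_return_labels:
  assumes "right_resolving G lab"
  shows "prefix_free return_labels"
  unfolding prefix_free_def
proof (intro ballI notI)
  fix s t assume "s \<in> return_labels" "t \<in> return_labels" and st: "strict_prefix s t"
  then obtain p q where p: "p \<in> return_walks" "s = map lab p"
    and q: "q \<in> return_walks" "t = map lab q"
    by (auto simp: return_labels_def)
  then have "prefix p q"
    using right_resolving_prefix_walk[OF assms, of v p v q v] st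
    by (auto simp: return_walks_def strict_prefix_def)
  moreover have "p \<noteq> q"
    using st p q by auto
  ultimately obtain f r where qr: "q = p @ f # r"
    by (metis append_Nil2 neq_Nil_conv prefixE)
  have "awalk v p v" "p \<noteq> []" "awalk v (p @ f # r) v"
    using p q qr by (auto simp: return_walks_def)
  then have "tail G f = v"
    by (auto simp: awalk_Cons_iff)
  with q qr \<open>p \<noteq> []\<close> show False
    by (auto simp: return_walks_def)
qed

lemma finite_return_labels:
  assumes cyc: "\<And>c. cycle c \<Longrightarrow> v \<in> tail G ` set c"
  shows "finite return_labels"
proof -
  have "p \<in> (\<Union>e\<in>arcs G. Cons e ` {q. apath (head G e) q v})" if ret: "p \<in> return_walks" for p
  proof -
    obtain e q where p: "p = e # q" and e: "e \<in> arcs G"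
      and q: "awalk (head G e) q v" "v \<notin> tail G ` set q"
      using ret by (cases p) (auto simp: return_walks_def awalk_Cons_iff)
    have "distinct (awalk_verts (head G e) q)"
    proof (rule ccontr)
      assume "\<not> ?thesis"
      from awalk_not_distinct_decomp[OF q(1) this] obtain a r s w
        where dec: "q = a @ r @ s" "awalk w r w" "r \<noteq> []"
        by blast
      then obtain c where "cycle c" "set c \<subseteq> set r"
        using closed_walk_contains_cycle by blast
      with cyc q(2) dec(1) show False
        by fastforce
    qed
    with p e q(1) show ?thesis
      by (auto simp: apath_def)
  qed
  then have "return_walks \<subseteq> (\<Union>e\<in>arcs G. Cons e ` {q. apath (head G e) q v})"
    by blast
  then have "finite return_walks"
    by (rule finite_subset) (simp add: apaths_finite)
  then show ?thesis
    by (simp add: return_labels_def)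
qed

end

lemma presentation_imp_return_labels:
  assumes "presentation m G lab v P" "right_resolving G lab" "strongly_connected G"
  shows "P = infinite_paths m
    (initial_segments {concat ss | ss. ss \<in> lists (pointed_graph.return_labels G lab v)})"
proof -
  interpret pointed_graph G m lab v
    using assms by (simp add: presentation_def)
  show ?thesis
    using assms labels_of_infinite_walks walk_labels_eq_initial_segments
    by (simp add: presentation_def)
qed

section \<open>The graph of a finite tree\<close>

text \<open>The tree with specifying set \<open>S\<close>, with its terminal nodes identified with the root. The arc
  into a node is named by that node, so an arc ending at a terminal node keeps its name although it
  leads back to the root. Strings are coded as numbers to obtain a graph on \<open>nat\<close>. The root is added
  explicitly since it is itself terminal when \<open>S = {[]}\<close>.\<close>

definition tree_graph :: "nat list set \<Rightarrow> (nat, nat) pre_digraph" where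
  "tree_graph S = \<lparr>
     verts = to_nat ` insert [] {p. \<exists>s\<in>S. strict_prefix p s},
     arcs = to_nat ` (initial_segments S - {[]}),
     tail = (\<lambda>e. to_nat (butlast (from_nat e :: nat list))),
     head = (\<lambda>e. to_nat (if from_nat e \<in> S then [] else from_nat e :: nat list))\<rparr>"

definition tree_label :: "nat \<Rightarrow> nat" where
  "tree_label e = last (from_nat e)"

abbreviation tree_root :: nat where
  "tree_root \<equiv> to_nat ([] :: nat list)"

lemma tree_graph_simps [simp]:
  "tail (tree_graph S) (to_nat p) = to_nat (butlast p)"
  "head (tree_graph S) (to_nat p) = to_nat (if p \<in> S then [] else p)"
  "to_nat p \<in> arcs (tree_graph S) \<longleftrightarrow> p \<in> initial_segments S \<and> p \<noteq> []"
  "tree_label (to_nat p) = last p"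
  by (auto simp: tree_graph_def tree_label_def)

lemma arcs_tree_graphE:
  assumes "e \<in> arcs (tree_graph S)"
  obtains p where "e = to_nat p" "p \<in> initial_segments S" "p \<noteq> []"
  using assms by (auto simp: tree_graph_def)

lemma vert_tree_graph_iff:
  "to_nat p \<in> verts (tree_graph S) \<longleftrightarrow> p = [] \<or> (\<exists>s\<in>S. strict_prefix p s)"
  by (auto simp: tree_graph_def)

lemma butlast_last_eqI:
  assumes "p \<noteq> []" "q \<noteq> []" "butlast p = butlast q" "last p = last q"
  shows "p = q"
  using assms by (metis append_butlast_last_id)

lemma tree_graph_pointed_graph:
  assumes "finite S" "S \<subseteq> lists {..<m}"
  shows "pointed_graph (tree_graph S) m tree_label tree_root"
proof
  have strict: "strict_prefix (butlast p) s" if "prefix p s" "p \<noteq> []" for p s :: "nat list"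
    using that by (metis append_butlast_last_id prefix_order.less_le_trans strict_prefixI')
  show "tail (tree_graph S) e \<in> verts (tree_graph S)" if "e \<in> arcs (tree_graph S)" for e
    using that strict
    by (elim arcs_tree_graphE) (auto simp: vert_tree_graph_iff initial_segments_def)
  show "head (tree_graph S) e \<in> verts (tree_graph S)" if "e \<in> arcs (tree_graph S)" for e
    using that
    by (elim arcs_tree_graphE)
      (auto simp: vert_tree_graph_iff initial_segments_def strict_prefix_def)
  have fin: "finite (initial_segments S)"
    using assms(1) by (rule finite_initial_segments)
  then show "finite (arcs (tree_graph S))"
    by (simp add: tree_graph_def)
  have "{p. \<exists>s\<in>S. strict_prefix p s} \<subseteq> initial_segments S"
    by (auto simp: initial_segments_def strict_prefix_def)
  with fin show "finite (verts (tree_graph S))"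
    by (auto simp: tree_graph_def intro: finite_subset)
  show "tree_label e < m" if e: "e \<in> arcs (tree_graph S)" for e
  proof -
    obtain p s where p: "e = to_nat p" "p \<noteq> []" "s \<in> S" "prefix p s"
      using e by (auto elim!: arcs_tree_graphE simp: initial_segments_def)
    then have "last p \<in> set s"
      using set_mono_prefix[of p s] by auto
    with p assms(2) show ?thesis
      by auto
  qed
  show "e = f" if "e \<in> arcs (tree_graph S)" "f \<in> arcs (tree_graph S)"
    "arc_to_ends (tree_graph S) e = arc_to_ends (tree_graph S) f" "tree_label e = tree_label f" for e f
    using that
    by (elim arcs_tree_graphE) (auto simp: arc_to_ends_def intro: butlast_last_eqI)
  show "tree_root \<in> verts (tree_graph S)"
    by (simp add: vert_tree_graph_iff)
qed

lemma right_resolving_tree_graph: "right_resolving (tree_graph S) tree_label"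
  unfolding right_resolving_def
proof (intro ballI inj_onI)
  fix u e f assume ef: "e \<in> out_arcs (tree_graph S) u" "f \<in> out_arcs (tree_graph S) u"
    and lab: "tree_label e = tree_label f"
  from ef obtain p q :: "nat list"
    where pq: "e = to_nat p" "p \<noteq> []" "f = to_nat q" "q \<noteq> []"
    by (auto elim!: arcs_tree_graphE)
  have "tail (tree_graph S) e = tail (tree_graph S) f"
    using ef by simp
  then have "butlast p = butlast q"
    by (simp add: pq)
  moreover have "last p = last q"
    using lab by (simp add: pq)
  ultimately show "e = f"
    using butlast_last_eqI[of p q] pq by simp
qed

text \<open>Walking down the branch of a terminal node \<open>s\<close>. Started at the root (\<open>k = 0\<close>), this walk shows
  that \<open>s\<close> is a return label, and as it is closed it connects every node on the branch to and from
  the root. The start \<open>k\<close> is general for the sake of the induction. Prefix-freeness guarantees that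
  the branch does not jump back to the root before its end.\<close>

lemma branch_walk:
  assumes "finite S" "S \<subseteq> lists {..<m}" "prefix_free S" "s \<in> S" "k < length s"
  shows "pre_digraph.awalk (tree_graph S) (to_nat (take k s))
    (map (\<lambda>i. to_nat (take (Suc i) s)) [k..<length s]) tree_root"
proof -
  interpret pointed_graph "tree_graph S" m tree_label tree_root
    using assms(1,2) by (rule tree_graph_pointed_graph)
  have arc: "to_nat (take (Suc i) s) \<in> arcs (tree_graph S)"
    "tail (tree_graph S) (to_nat (take (Suc i) s)) = to_nat (take i s)" if "i < length s" for i
    using that assms(4) by
      (auto simp: initial_segments_def butlast_take intro!: bexI[of _ s] take_is_prefix)
  have inner: "take (Suc i) s \<notin> S" if "Suc i < length s" for i
  proof
    assume "take (Suc i) s \<in> S"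
    moreover have "strict_prefix (take (Suc i) s) s"
      using that by (metis length_take min.absorb4 nat_neq_iff strict_prefix_def take_is_prefix)
    ultimately show False
      using assms(3,4) by (auto simp: prefix_free_def)
  qed
  from assms(5) show ?thesis
  proof (induction "length s - Suc k" arbitrary: k)
    case 0
    then have "Suc k = length s"
      by simp
    then have "[k..<length s] = [k]"
      by (metis upt_rec upt_conv_Nil lessI order_refl)
    then show ?case
      using arc[of k] 0 assms(4) \<open>Suc k = length s\<close> distinguished_vertex
      by (simp add: awalk_simps)
  next
    case (Suc n)
    then have "[k..<length s] = k # [Suc k..<length s]"
      by (simp add: upt_conv_Cons)
    moreover have "awalk (to_nat (take (Suc k) s))
        (map (\<lambda>i. to_nat (take (Suc i) s)) [Suc k..<length s]) tree_root"
      using Suc by simp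
    ultimately show ?case
      using arc[of k] inner[of k] Suc by (simp add: awalk_Cons_iff)
  qed
qed

lemma strongly_connected_tree_graph:
  assumes "finite S" "S \<subseteq> lists {..<m}" "prefix_free S"
  shows "strongly_connected (tree_graph S)"
proof -
  interpret pointed_graph "tree_graph S" m tree_label tree_root
    using assms(1,2) by (rule tree_graph_pointed_graph)
  have "u \<rightarrow>\<^sup>*\<^bsub>tree_graph S\<^esub> tree_root \<and> tree_root \<rightarrow>\<^sup>*\<^bsub>tree_graph S\<^esub> u" if u: "u \<in> verts (tree_graph S)" for u
  proof (cases "u = tree_root")
    case True
    then show ?thesis
      using distinguished_vertex by simp
  next
    case False
    then obtain p s where p: "u = to_nat p" "s \<in> S" "strict_prefix p s"
      using u by (auto simp: tree_graph_def)
    define k where "k = length p"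
    have k: "k < length s" "p = take k s"
      using p(3) by (auto simp: k_def strict_prefix_def prefix_def)
    let ?w = "map (\<lambda>i. to_nat (take (Suc i) s)) [0..<length s]"
    have "0 < length s"
      using k by linarith
    from branch_walk[OF assms p(2) this] have walk: "awalk tree_root ?w tree_root"
      by simp
    have "u = tail (tree_graph S) (to_nat (take (Suc k) s))"
      using k p(1) by (simp add: butlast_take)
    also have "\<dots> \<in> set (awalk_verts tree_root ?w)"
      using k by (intro awalk_verts_arc1) simp
    finally show ?thesis
      using awalk_verts_reachable_from[OF walk] awalk_verts_reachable_to[OF walk] by blast
  qed
  then show ?thesis
    using distinguished_vertex unfolding strongly_connected_def by (blast intro: reachable_trans)
qed

text \<open>As long as a walk from the root does not visit the root again, it moves down the tree, so its
  last arc, being named by the node reached, records all labels read so far. The walk returns to the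
  root exactly when this node is terminal. Conversely, the walk down the branch of a terminal node is
  a first return.\<close>

lemma return_labels_tree_graph:
  assumes "finite S" "S \<subseteq> lists {..<m}" "prefix_free S"
  shows "pointed_graph.return_labels (tree_graph S) tree_label tree_root = S - {[]}"
proof -
  interpret pointed_graph "tree_graph S" m tree_label tree_root
    using assms(1,2) by (rule tree_graph_pointed_graph)
  have last_arc: "map tree_label p = from_nat (last p)"
    if "awalk tree_root p u" "p \<noteq> []" "tree_root \<notin> tail (tree_graph S) ` set (tl p)" for p u
    using that
  proof (induction p arbitrary: u rule: rev_induct)
    case (snoc e q)
    obtain t :: "nat list" where t: "e = to_nat t" "t \<in> initial_segments S" "t \<noteq> []"
      using snoc.prems by (auto simp: awalk_Cons_iff elim: arcs_tree_graphE)
    show ?case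
    proof (cases "q = []")
      case True
      then have "butlast t = []"
        using snoc.prems t by (simp add: awalk_simps)
      then show ?thesis
        using True t by (metis append_Nil append_butlast_last_id from_nat_to_nat last_snoc list.map
            tree_graph_simps(4))
    next
      case False
      have walk_q: "awalk tree_root q (awlast tree_root q)"
        and e: "awlast tree_root q = tail (tree_graph S) e"
        using snoc.prems by (auto simp: awalk_Cons_iff)
      have IH: "map tree_label q = from_nat (last q)"
        using snoc.IH[OF walk_q] False snoc.prems by auto
      have "awlast tree_root q = head (tree_graph S) (last q)"
        using False by (simp add: awalk_verts_conv)
      moreover have "last q \<in> arcs (tree_graph S)"
        using walk_q False by (auto simp: awalk_def)
      then obtain s :: "nat list" where s: "last q = to_nat s"
        by (rule arcs_tree_graphE)
      moreover have "tail (tree_graph S) e \<noteq> tree_root"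
        using snoc.prems False by auto
      ultimately have "butlast t = s"
        using e t by (auto split: if_splits)
      then have "s @ [last t] = t"
        using t by auto
      then show ?thesis
        using IH s t by simp
    qed
  qed simp
  show ?thesis
  proof (intro equalityI subsetI)
    fix x assume "x \<in> return_labels"
    then obtain p where p: "p \<in> return_walks" "x = map tree_label p"
      by (auto simp: return_labels_def)
    then have walk: "awalk tree_root p tree_root" "p \<noteq> []"
      and x: "x = from_nat (last p)"
      using last_arc by (auto simp: return_walks_def)
    have "last p \<in> arcs (tree_graph S)"
      using walk by (auto simp: awalk_def)
    then obtain t :: "nat list" where t: "last p = to_nat t" "t \<noteq> []"
      by (rule arcs_tree_graphE)
    have "head (tree_graph S) (last p) = tree_root"
      using walk awlast_of_awalk[of tree_root p tree_root] by (auto simp: awalk_verts_conv)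
    then have "t \<in> S"
      using t by (auto split: if_splits)
    with t x show "x \<in> S - {[]}"
      by simp
  next
    fix s assume s: "s \<in> S - {[]}"
    let ?w = "map (\<lambda>i. to_nat (take (Suc i) s)) [0..<length s]"
    have "awalk tree_root ?w tree_root"
      using branch_walk[OF assms, of s 0] s by simp
    moreover have "tl ?w = map (\<lambda>i. to_nat (take (Suc i) s)) [Suc 0..<length s]"
      by (simp flip: map_tl)
    then have "tree_root \<notin> tail (tree_graph S) ` set (tl ?w)"
      by (auto simp: butlast_take)
    moreover have "?w \<noteq> []"
      using s by simp
    ultimately have "?w \<in> return_walks"
      by (simp add: return_walks_def)
    moreover have "map tree_label ?w = s"
      by (rule nth_equalityI) (auto simp: take_Suc_conv_app_nth)
    ultimately show "s \<in> return_labels"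
      unfolding return_labels_def by (metis imageI)
  qed
qed

section \<open>Path sets and self-similar fractal trees\<close>

lemma fractal_tree_presentation:
  assumes "finite_tree m T"
  shows "presentation m (tree_graph (terminal_nodes T)) tree_label tree_root (fractal_tree m T)"
    and "strongly_connected (tree_graph (terminal_nodes T))"
proof -
  obtain S where S: "finite S" "S \<subseteq> lists {..<m}" "prefix_free S" and T: "T = initial_segments S"
    using assms by (auto simp: finite_tree_def)
  let ?G = "tree_graph S"
  have nodes: "terminal_nodes T = S"
    using S T by (simp add: terminal_nodes_initial_segments)
  show sc: "strongly_connected (tree_graph (terminal_nodes T))"
    using S nodes strongly_connected_tree_graph by simp
  have pres: "presentation m ?G tree_label tree_root
      {tree_label \<circ> w | w. infinite_walk ?G tree_root w}"
    using S tree_graph_pointed_graph by (simp add: presentation_def)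
  with presentation_imp_return_labels[OF pres right_resolving_tree_graph] sc
  show "presentation m (tree_graph (terminal_nodes T)) tree_label tree_root (fractal_tree m T)"
    using S nodes by (simp add: T return_labels_tree_graph fractal_tree_initial_segments)
qed

lemma path_set_is_fractal_tree:
  assumes "presentation m G lab v P" "right_resolving G lab" "strongly_connected G"
    and cyc: "\<And>p. pre_digraph.cycle G p \<Longrightarrow> v \<in> tail G ` set p"
  shows "\<exists>T. finite_tree m T \<and> P = fractal_tree m T"
proof -
  interpret pointed_graph G m lab v
    using assms by (simp add: presentation_def)
  \<comment> \<open>A tree needs a terminal node, so the empty string stands in when there is no return label.\<close>
  define S where "S = (if return_labels = {} then {[]} else return_labels)"
  have S: "finite S" "S \<noteq> {}" "S \<subseteq> lists {..<m}" "prefix_free S"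
    using finite_return_labels[OF cyc] return_labels_subset prefix_free_return_labels[OF assms(2)]
    by (auto simp: S_def) (simp_all add: prefix_free_def)
  then have "finite_tree m (initial_segments S)"
    by (auto simp: finite_tree_def)
  moreover have "S - {[]} = return_labels"
    using return_labels_not_Nil by (auto simp: S_def)
  then have "P = fractal_tree m (initial_segments S)"
    using presentation_imp_return_labels[OF assms(1-3)] fractal_tree_initial_segments[OF S(4)]
    by simp
  ultimately show ?thesis
    by blast
qed

theorem theorem5p1:
  fixes m :: nat
  assumes "m > 0"
  shows
    "(\<forall>T. finite_tree m T \<longrightarrow>
        path_set m (fractal_tree m T) \<and>
        (\<exists>(G :: (nat, nat) pre_digraph) lab v.
           presentation m G lab v (fractal_tree m T) \<and>
           right_resolving G lab \<and> strongly_connected G))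
     \<and>
     (\<forall>P (G :: ('v, 'e) pre_digraph) lab v.
        presentation m G lab v P \<and> right_resolving G lab \<and> strongly_connected G \<and>
        (\<forall>e. multiple_edge G e \<longrightarrow> head G e = v) \<and>
        (\<forall>p. pre_digraph.cycle G p \<longrightarrow> v \<in> tail G ` set p) \<longrightarrow>
        (\<exists>T. finite_tree m T \<and> P = fractal_tree m T))"
proof (intro conjI allI impI)
  fix T assume "finite_tree m T"
  note pres = fractal_tree_presentation[OF this]
  show "path_set m (fractal_tree m T)"
    using pres(1) by (rule presentation_imp_path_set)
  show "\<exists>(G :: (nat, nat) pre_digraph) lab v. presentation m G lab v (fractal_tree m T) \<and>
      right_resolving G lab \<and> strongly_connected G"
    using pres right_resolving_tree_graph by blast
next
  fix P and G :: "('v, 'e) pre_digraph" and lab v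
  assume "presentation m G lab v P \<and> right_resolving G lab \<and> strongly_connected G \<and>
    (\<forall>e. multiple_edge G e \<longrightarrow> head G e = v) \<and>
    (\<forall>p. pre_digraph.cycle G p \<longrightarrow> v \<in> tail G ` set p)"
  then show "\<exists>T. finite_tree m T \<and> P = fractal_tree m T"
    by (intro path_set_is_fractal_tree[of m G lab v]) auto
qed

end
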